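(* Let $\varphi:\mathbb{R}^{q\times p}\to\mathbb{R}$ be a convex and Lipschitz continuous function with Lipschitz constant $\rho>0$. Then the following statements hold: (i) $\lim_{Z\to Y,\ \mu\downarrow0}\mathrm{env}_\varphi(Z,\mu)=\varphi(Y)$ for all $Y\in\mathbb{R}^{q\times p}$. (ii) $\|\nabla_Z\mathrm{env}_\varphi(Z,\mu)\|_F\le2\rho$ for all $(Z,\mu)\in\mathbb{R}^{q\times p}\times(0,+\infty)$. (iii) $\Big\{\lim_{Z\to Y,\ \mu\downarrow0}\nabla_Z\mathrm{env}_\varphi(Z,\mu)\Big\}\subseteq\partial\varphi(Y)$ for all $Y\in\mathbb{R}^{q\times p}$.
   Context: For a convex function $\varphi$ on $\mathbb{R}^{q\times p}$ and $\mu>0$, the Moreau envelope is $\mathrm{env}_\varphi(Z,\mu):=\min_{Y\in\mathbb{R}^{q\times p}}\{\varphi(Y)+\frac1{2\mu}\|Y-Z\|_F^2\}$, which is differentiable in $Z$. $\|\cdot\|_F$ is the Frobenius norm and Lipschitz continuity is with respect to it. $\partial\varphi$ is the convex subdifferential. The set on the left side of (iii) is the set of all limits of $\nabla_Z\mathrm{env}_\varphi(Z_k,\mu_k)$ along sequences $Z_k\to Y$, $\mu_k\downarrow0$ ($\mu_k>0$) for which this limit exists. *)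

theory Defs
  imports "HOL-Analysis.Analysis"
begin

text \<open>A \<open>q \<times> p\<close> real matrix has type \<^typ>\<open>real^'p^'q\<close>. The library's \<^const>\<open>norm\<close> and
  \<^const>\<open>inner\<close> on this type are the Frobenius norm and the trace inner product:\<close>

lemma norm_matrix_frobenius:
  fixes A :: "real^'p^'q"
  shows "norm A = sqrt (\<Sum>i\<in>UNIV. \<Sum>j\<in>UNIV. (A $ i $ j)\<^sup>2)"
  by (simp add: norm_vec_def L2_set_def sum_nonneg)

lemma inner_matrix_frobenius:
  fixes A B :: "real^'p^'q"
  shows "inner A B = trace (transpose A ** B)"
proof -
  have "inner A B = (\<Sum>i\<in>UNIV. \<Sum>j\<in>UNIV. A $ i $ j * B $ i $ j)"
    by (simp add: inner_vec_def)
  also have "\<dots> = (\<Sum>j\<in>UNIV. \<Sum>i\<in>UNIV. A $ i $ j * B $ i $ j)"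
    by (rule sum.swap)
  finally show ?thesis
    by (simp add: trace_def transpose_def matrix_matrix_mult_def)
qed

text \<open>The minimum over \<open>Y\<close> is the least element of the set of values (not merely an infimum);
  it exists when \<open>\<phi>\<close> is convex on a finite-dimensional space and \<open>\<mu> > 0\<close>.\<close>

definition moreau_env :: "('a::real_inner \<Rightarrow> real) \<Rightarrow> 'a \<Rightarrow> real \<Rightarrow> real" where
  "moreau_env \<phi> Z \<mu> = (LEAST v. \<exists>Y. v = \<phi> Y + 1 / (2 * \<mu>) * (norm (Y - Z))\<^sup>2)"

definition gradient :: "('a::real_inner \<Rightarrow> real) \<Rightarrow> 'a \<Rightarrow> 'a" where
  "gradient f x = (THE D. GDERIV f x :> D)"

lemma gradient_eqI:
  assumes "GDERIV f x :> D"
  shows "gradient f x = D"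
  unfolding gradient_def
proof (rule the_equality)
  show "GDERIV f x :> D" by fact
  fix E assume "GDERIV f x :> E"
  then have "(\<lambda>h. inner h E) = (\<lambda>h. inner h D)"
    using assms unfolding gderiv_def by (rule has_derivative_unique)
  then show "E = D"
    by (metis inner_commute vector_eq_rdot)
qed

definition subdifferential :: "('a::real_inner \<Rightarrow> real) \<Rightarrow> 'a \<Rightarrow> 'a set" where
  "subdifferential \<phi> Y = {G. \<forall>X. \<phi> X \<ge> \<phi> Y + inner G (X - Y)}"

text \<open>The condition \<open>\<mu>\<^sub>k \<down> 0\<close> is read as convergence to 0 through positive values, without
  monotonicity.\<close>

definition env_gradient_limits :: "('a::real_inner \<Rightarrow> real) \<Rightarrow> 'a \<Rightarrow> 'a set" where
  "env_gradient_limits \<phi> Y =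
    {G. \<exists>(Z :: nat \<Rightarrow> 'a) (\<mu> :: nat \<Rightarrow> real).
        Z \<longlonglongrightarrow> Y \<and> (\<forall>k. \<mu> k > 0) \<and> \<mu> \<longlonglongrightarrow> 0 \<and>
        (\<lambda>k. gradient (\<lambda>W. moreau_env \<phi> W (\<mu> k)) (Z k)) \<longlonglongrightarrow> G}"

end

theory Submission
  imports Defs
begin

text \<open>
  Everything follows from looking at a point \<open>P\<close> where the minimum defining the envelope at
  \<open>(Z, \<mu>)\<close> is attained (a proximal point of \<open>Z\<close>) and at the vector \<open>G = (Z - P) / \<mu>\<close>.

  Lipschitz continuity makes the quadratic penalty win far away from \<open>Z\<close>: comparing the values at
  \<open>P\<close> and at \<open>Z\<close> gives \<open>\<parallel>P - Z\<parallel> \<le> 2 \<mu> \<rho>\<close> (\<open>is_prox_dist_le\<close>), and the same comparison reduces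
  the existence of \<open>P\<close> to minimization over a compact ball (\<open>is_prox_exists\<close>). Hence
  \<open>\<parallel>G\<parallel> \<le> 2 \<rho>\<close>, and the envelope differs from \<open>\<phi> Z\<close> by at most \<open>2 \<rho>\<^sup>2 \<mu>\<close>, uniformly in \<open>Z\<close>;
  with the continuity of \<open>\<phi>\<close>, the latter gives the joint limit (i).

  Convexity turns the minimality of \<open>P\<close> into the optimality condition \<open>G \<in> \<partial>\<phi>(P)\<close>
  (\<open>is_prox_subgradient\<close>). The affine minorant of \<open>\<phi>\<close> with slope \<open>G\<close> bounds the envelope from
  below, the fixed candidate \<open>P\<close> bounds it from above, and the two bounds differ by
  \<open>\<parallel>W - Z\<parallel>\<^sup>2 / (2 \<mu>)\<close>; so the gradient of the envelope at \<open>Z\<close> is exactly \<open>G\<close>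
  (\<open>moreau_env_has_gradient\<close>), which proves (ii).

  For (iii), the gradients along a sequence are subgradients at proximal points \<open>P\<^sub>k\<close>, these
  satisfy \<open>\<parallel>P\<^sub>k - Z\<^sub>k\<parallel> \<le> 2 \<mu>\<^sub>k \<rho>\<close> and so tend to the limit \<open>Y\<close> of \<open>Z\<^sub>k\<close>, and the graph of the
  subdifferential of a continuous function is closed (\<open>subdifferential_closed_graph\<close>).
\<close>

section \<open>Proximal points\<close>

lemma power2_norm_add_scaleR:
  fixes a b :: "'a::real_inner"
  shows "(norm (a + t *\<^sub>R b))\<^sup>2 = (norm a)\<^sup>2 + 2 * t * inner a b + t\<^sup>2 * (norm b)\<^sup>2"
  by (simp add: power2_norm_eq_inner inner_add_left inner_add_right inner_commute[of b a])
    (simp add: power2_eq_square algebra_simps)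

definition is_prox :: "('a::real_inner \<Rightarrow> real) \<Rightarrow> real \<Rightarrow> 'a \<Rightarrow> 'a \<Rightarrow> bool" where
  "is_prox \<phi> \<mu> Z P \<longleftrightarrow>
    (\<forall>Y. \<phi> P + 1 / (2 * \<mu>) * (norm (P - Z))\<^sup>2 \<le> \<phi> Y + 1 / (2 * \<mu>) * (norm (Y - Z))\<^sup>2)"

lemma moreau_env_eq_prox:
  assumes "is_prox \<phi> \<mu> Z P"
  shows "moreau_env \<phi> Z \<mu> = \<phi> P + 1 / (2 * \<mu>) * (norm (P - Z))\<^sup>2"
  unfolding moreau_env_def
  by (rule Least_equality) (use assms in \<open>auto simp: is_prox_def\<close>)

text \<open>The penalty grows quadratically while \<open>\<phi>\<close> can decrease at most linearly, so no point beyond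
  distance \<open>2 \<mu> \<rho>\<close> can do as well as \<open>Z\<close> itself.\<close>

lemma lipschitz_sublevel_dist_le:
  fixes \<phi> :: "'a::real_inner \<Rightarrow> real"
  assumes lip: "\<rho>-lipschitz_on UNIV \<phi>" and "\<mu> > 0"
    and le: "\<phi> P + 1 / (2 * \<mu>) * (norm (P - Z))\<^sup>2 \<le> \<phi> Z"
  shows "norm (P - Z) \<le> 2 * \<mu> * \<rho>"
proof (cases "P = Z")
  case True
  then show ?thesis using lipschitz_on_nonneg[OF lip] \<open>\<mu> > 0\<close> by simp
next
  case False
  have "\<bar>\<phi> P - \<phi> Z\<bar> \<le> \<rho> * norm (P - Z)"
    using lipschitz_onD[OF lip, of P Z] by (simp add: dist_norm)
  then have "1 / (2 * \<mu>) * (norm (P - Z))\<^sup>2 \<le> \<rho> * norm (P - Z)"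
    using le by linarith
  then have "norm (P - Z) * norm (P - Z) \<le> (2 * \<mu> * \<rho>) * norm (P - Z)"
    using \<open>\<mu> > 0\<close> by (simp add: field_simps power2_eq_square)
  then show ?thesis
    using False by (simp only: mult_le_cancel_right) auto
qed

lemma is_prox_dist_le:
  fixes \<phi> :: "'a::real_inner \<Rightarrow> real"
  assumes "\<rho>-lipschitz_on UNIV \<phi>" and "\<mu> > 0" and "is_prox \<phi> \<mu> Z P"
  shows "norm (P - Z) \<le> 2 * \<mu> * \<rho>"
proof (rule lipschitz_sublevel_dist_le[OF assms(1,2)])
  show "\<phi> P + 1 / (2 * \<mu>) * (norm (P - Z))\<^sup>2 \<le> \<phi> Z"
    using assms(3)[unfolded is_prox_def, rule_format, of Z] by simp
qed

lemma is_prox_exists: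
  fixes \<phi> :: "'a::euclidean_space \<Rightarrow> real"
  assumes lip: "\<rho>-lipschitz_on UNIV \<phi>" and "\<mu> > 0"
  shows "\<exists>P. is_prox \<phi> \<mu> Z P"
proof -
  define F where "F = (\<lambda>Y. \<phi> Y + 1 / (2 * \<mu>) * (norm (Y - Z))\<^sup>2)"
  define B where "B = cball Z (2 * \<mu> * \<rho>)"
  have ZB: "Z \<in> B"
    using lipschitz_on_nonneg[OF lip] \<open>\<mu> > 0\<close> by (simp add: B_def)
  have "continuous_on B F"
    unfolding F_def
    by (intro continuous_intros continuous_on_subset[OF lipschitz_on_continuous_on[OF lip]]) auto
  then obtain P where P: "\<And>Y. Y \<in> B \<Longrightarrow> F P \<le> F Y"
    using continuous_attains_inf[of B F] ZB by (metis B_def compact_cball empty_iff)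
  have "F P \<le> F Y" for Y
  proof (cases "Y \<in> B")
    case False
    then have "\<not> F Y \<le> \<phi> Z"
      using lipschitz_sublevel_dist_le[OF lip \<open>\<mu> > 0\<close>, of Y Z]
      by (auto simp: B_def F_def dist_norm norm_minus_commute)
    then show ?thesis
      using P[OF ZB] by (simp add: F_def)
  qed (rule P)
  then show ?thesis
    by (auto simp: is_prox_def F_def)
qed

text \<open>First-order optimality: along the segment from \<open>P\<close> to \<open>X\<close>, convexity bounds the increase of
  \<open>\<phi>\<close> by a linear function of \<open>t\<close>, while the penalty is differentiable with slope
  \<open>-G \<bullet> (X - P)\<close> at \<open>t = 0\<close>, where \<open>G = (Z - P) / \<mu>\<close>. Minimality at \<open>t = 0\<close> then forces the linear terms to have a
  nonnegative sum.\<close>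

lemma is_prox_subgradient:
  fixes \<phi> :: "'a::real_inner \<Rightarrow> real"
  assumes conv: "convex_on UNIV \<phi>" and "\<mu> > 0" and prox: "is_prox \<phi> \<mu> Z P"
  shows "(1 / \<mu>) *\<^sub>R (Z - P) \<in> subdifferential \<phi> P"
proof -
  have "\<phi> P + inner ((1 / \<mu>) *\<^sub>R (Z - P)) (X - P) \<le> \<phi> X" for X
  proof -
    define a where "a = \<phi> X - \<phi> P - inner ((1 / \<mu>) *\<^sub>R (Z - P)) (X - P)"
    define b where "b = 1 / (2 * \<mu>) * (norm (X - P))\<^sup>2"
    have ineq: "0 \<le> a + t * b" if t: "0 < t" "t < 1" for t
    proof -
      define Y where "Y = (1 - t) *\<^sub>R P + t *\<^sub>R X"
      have "\<phi> Y \<le> \<phi> P + t * (\<phi> X - \<phi> P)"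
        unfolding Y_def using convex_onD[OF conv, of t P X] t by (simp add: algebra_simps)
      moreover have "(norm (Y - Z))\<^sup>2 =
          (norm (P - Z))\<^sup>2 + (t\<^sup>2 * (norm (X - P))\<^sup>2 - 2 * t * inner (Z - P) (X - P))"
      proof -
        have "Y - Z = (P - Z) + t *\<^sub>R (X - P)"
          by (simp add: Y_def algebra_simps)
        moreover have "inner (P - Z) (X - P) = - inner (Z - P) (X - P)"
          by (simp add: inner_diff_left)
        ultimately show ?thesis
          by (simp only: power2_norm_add_scaleR)
      qed
      moreover have "\<phi> P + 1 / (2 * \<mu>) * (norm (P - Z))\<^sup>2
          \<le> \<phi> Y + 1 / (2 * \<mu>) * (norm (Y - Z))\<^sup>2"
        using prox by (simp add: is_prox_def)
      ultimately have "0 \<le> t * (\<phi> X - \<phi> P) + 1 / (2 * \<mu>) *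
          (t\<^sup>2 * (norm (X - P))\<^sup>2 - 2 * t * inner (Z - P) (X - P))"
        by (simp only: distrib_left[of "1 / (2 * \<mu>)"])
      also have "\<dots> = t * (a + t * b)"
        using \<open>\<mu> > 0\<close> by (simp only: a_def b_def inner_scaleR_left) (simp add: field_simps power2_eq_square)
      finally show ?thesis
        using t by (simp add: zero_le_mult_iff)
    qed
    have "((\<lambda>t. a + t * b) \<longlongrightarrow> a + 0 * b) (at_right 0)"
      by (intro tendsto_intros)
    moreover have "\<forall>\<^sub>F t in at_right 0. 0 \<le> a + t * b"
      using eventually_at_right_real[OF zero_less_one] by eventually_elim (use ineq in auto)
    ultimately have "0 \<le> a"
      using tendsto_lowerbound[of "\<lambda>t. a + t * b" a "at_right 0" 0] by simp
    then show ?thesis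
      by (simp add: a_def)
  qed
  then show ?thesis
    by (simp add: subdifferential_def)
qed

section \<open>Differentiability of the envelope\<close>

text \<open>The lower bound says that the error of the linear approximation is nonnegative, the upper
  bound that it is at most \<open>c \<parallel>W - Z\<parallel>\<^sup>2\<close>, which is \<open>o(\<parallel>W - Z\<parallel>)\<close>.\<close>

lemma gderivI_quadratic_bounds:
  fixes f :: "'a::real_inner \<Rightarrow> real"
  assumes lower: "\<And>W. f Z + inner G (W - Z) \<le> f W"
    and upper: "\<And>W. f W \<le> f Z + inner G (W - Z) + c * (norm (W - Z))\<^sup>2"
  shows "GDERIV f Z :> G"
proof -
  have "((\<lambda>W. norm (f W - f Z - inner (W - Z) G) / norm (W - Z)) \<longlongrightarrow> 0) (at Z)"
  proof (rule Lim_null_comparison)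
    show "\<forall>\<^sub>F W in at Z. norm (norm (f W - f Z - inner (W - Z) G) / norm (W - Z))
        \<le> c * norm (W - Z)"
    proof (rule eventually_at_topological[THEN iffD2], intro exI[of _ UNIV] conjI ballI impI)
      fix W assume "W \<noteq> Z"
      moreover have "\<bar>f W - f Z - inner (W - Z) G\<bar> \<le> c * (norm (W - Z))\<^sup>2"
        using lower[of W] upper[of W] by (simp add: inner_commute)
      ultimately show "norm (norm (f W - f Z - inner (W - Z) G) / norm (W - Z))
          \<le> c * norm (W - Z)"
        by (simp add: divide_le_eq power2_eq_square mult.assoc)
    qed auto
    have "((\<lambda>W. c * norm (W - Z)) \<longlongrightarrow> c * norm (Z - Z)) (at Z)"
      by (intro tendsto_intros)
    then show "((\<lambda>W. c * norm (W - Z)) \<longlongrightarrow> 0) (at Z)"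
      by simp
  qed
  then show ?thesis
    unfolding gderiv_def has_derivative_iff_norm
    by (simp add: bounded_linear_inner_left)
qed

text \<open>Upper bound: keep \<open>P\<close> as a candidate when the centre moves to \<open>W\<close>. Lower bound: replace \<open>\<phi>\<close>
  by its affine minorant at \<open>P\<close> with slope \<open>G\<close>; what remains is a completed square.\<close>

lemma moreau_env_has_gradient:
  fixes \<phi> :: "'a::euclidean_space \<Rightarrow> real"
  assumes conv: "convex_on UNIV \<phi>" and lip: "\<rho>-lipschitz_on UNIV \<phi>" and "\<mu> > 0"
    and prox: "is_prox \<phi> \<mu> Z P"
  shows "GDERIV (\<lambda>W. moreau_env \<phi> W \<mu>) Z :> (1 / \<mu>) *\<^sub>R (Z - P)"
proof (rule gderivI_quadratic_bounds)
  define G where "G = (1 / \<mu>) *\<^sub>R (Z - P)"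
  have ZP: "Z - P = \<mu> *\<^sub>R G"
    using \<open>\<mu> > 0\<close> by (simp add: G_def)
  have env_Z: "moreau_env \<phi> Z \<mu> = \<phi> P + \<mu> / 2 * inner G G"
  proof -
    have "(norm (P - Z))\<^sup>2 = \<mu>\<^sup>2 * inner G G"
      by (simp add: norm_minus_commute[of P] ZP power_mult_distrib flip: power2_norm_eq_inner)
    then show ?thesis
      using \<open>\<mu> > 0\<close> by (simp add: moreau_env_eq_prox[OF prox] power2_eq_square)
  qed
  fix W
  obtain Q where Q: "is_prox \<phi> \<mu> W Q"
    using is_prox_exists[OF lip \<open>\<mu> > 0\<close>] by blast
  show "moreau_env \<phi> Z \<mu> + inner ((1 / \<mu>) *\<^sub>R (Z - P)) (W - Z) \<le> moreau_env \<phi> W \<mu>"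
  proof -
    define d where "d = Q - W"
    have "\<phi> P + inner G (Q - P) \<le> \<phi> Q"
      using is_prox_subgradient[OF conv \<open>\<mu> > 0\<close> prox] by (simp add: subdifferential_def G_def)
    moreover have "inner G (Q - P) = inner G d + inner G (W - Z) + \<mu> * inner G G"
    proof -
      have "Q - P = d + (W - Z) + \<mu> *\<^sub>R G"
        by (simp add: d_def ZP[symmetric])
      then show ?thesis
        by (simp add: inner_add_right)
    qed
    moreover have "0 \<le> 1 / (2 * \<mu>) * (norm (d + \<mu> *\<^sub>R G))\<^sup>2"
      using \<open>\<mu> > 0\<close> by simp
    moreover have "1 / (2 * \<mu>) * (norm (d + \<mu> *\<^sub>R G))\<^sup>2
        = 1 / (2 * \<mu>) * (norm d)\<^sup>2 + inner G d + \<mu> / 2 * inner G G"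
      using \<open>\<mu> > 0\<close>
      by (simp only: power2_norm_add_scaleR inner_commute[of d])
        (simp add: field_simps power2_eq_square flip: power2_norm_eq_inner)
    ultimately show ?thesis
      unfolding env_Z moreau_env_eq_prox[OF Q] G_def[symmetric] d_def[symmetric] by simp
  qed
  show "moreau_env \<phi> W \<mu> \<le> moreau_env \<phi> Z \<mu> + inner ((1 / \<mu>) *\<^sub>R (Z - P)) (W - Z)
      + 1 / (2 * \<mu>) * (norm (W - Z))\<^sup>2"
  proof -
    have "moreau_env \<phi> W \<mu> \<le> \<phi> P + 1 / (2 * \<mu>) * (norm (P - W))\<^sup>2"
      using Q by (simp add: is_prox_def moreau_env_eq_prox[OF Q])
    also have "norm (P - W) = norm ((W - Z) + \<mu> *\<^sub>R G)"
      by (simp add: norm_minus_commute[of P] ZP[symmetric])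
    also have "1 / (2 * \<mu>) * (norm ((W - Z) + \<mu> *\<^sub>R G))\<^sup>2
        = 1 / (2 * \<mu>) * (norm (W - Z))\<^sup>2 + inner G (W - Z) + \<mu> / 2 * inner G G"
      using \<open>\<mu> > 0\<close>
      by (simp only: power2_norm_add_scaleR inner_commute[of "W - Z"])
        (simp add: field_simps power2_eq_square flip: power2_norm_eq_inner)
    finally show ?thesis
      unfolding env_Z G_def[symmetric] by simp
  qed
qed

section \<open>Limits as the parameter tends to zero\<close>

lemma moreau_env_uniform_approx:
  fixes \<phi> :: "'a::euclidean_space \<Rightarrow> real"
  assumes lip: "\<rho>-lipschitz_on UNIV \<phi>" and "\<mu> > 0"
  shows "\<bar>moreau_env \<phi> Z \<mu> - \<phi> Z\<bar> \<le> 2 * \<rho>\<^sup>2 * \<mu>"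
proof -
  obtain P where P: "is_prox \<phi> \<mu> Z P"
    using is_prox_exists[OF assms] by blast
  have "moreau_env \<phi> Z \<mu> \<le> \<phi> Z"
    using P[unfolded is_prox_def, rule_format, of Z] by (simp add: moreau_env_eq_prox[OF P])
  moreover have "\<phi> P \<le> moreau_env \<phi> Z \<mu>"
    using \<open>\<mu> > 0\<close> by (simp add: moreau_env_eq_prox[OF P])
  moreover have "\<bar>\<phi> P - \<phi> Z\<bar> \<le> \<rho> * norm (P - Z)"
    using lipschitz_onD[OF lip, of P Z] by (simp add: dist_norm)
  moreover have "\<rho> * norm (P - Z) \<le> \<rho> * (2 * \<mu> * \<rho>)"
    by (intro mult_left_mono is_prox_dist_le[OF lip \<open>\<mu> > 0\<close> P] lipschitz_on_nonneg[OF lip])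
  moreover have "\<rho> * (2 * \<mu> * \<rho>) = 2 * \<rho>\<^sup>2 * \<mu>"
    by (simp add: power2_eq_square)
  ultimately show ?thesis
    by linarith
qed

text \<open>For each fixed \<open>X\<close> the subgradient inequality is non-strict and continuous in the base point
  and the slope, so it survives the limit.\<close>

lemma subdifferential_closed_graph:
  fixes \<phi> :: "'a::real_inner \<Rightarrow> real"
  assumes "isCont \<phi> Y" and "P \<longlonglongrightarrow> Y" and "g \<longlonglongrightarrow> G"
    and sub: "\<And>k::nat. g k \<in> subdifferential \<phi> (P k)"
  shows "G \<in> subdifferential \<phi> Y"
proof -
  have "\<phi> Y + inner G (X - Y) \<le> \<phi> X" for X
  proof (rule LIMSEQ_le_const2)
    show "(\<lambda>k. \<phi> (P k) + inner (g k) (X - P k)) \<longlonglongrightarrow> \<phi> Y + inner G (X - Y)"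
      by (intro tendsto_intros isCont_tendsto_compose[OF assms(1)] assms(2,3))
    show "\<exists>N. \<forall>k\<ge>N. \<phi> (P k) + inner (g k) (X - P k) \<le> \<phi> X"
      using sub by (auto simp: subdifferential_def)
  qed
  then show ?thesis
    by (simp add: subdifferential_def)
qed

theorem proposition3p2:
  fixes \<phi> :: "real^'p^'q \<Rightarrow> real" and \<rho> :: real
  assumes "convex_on UNIV \<phi>"
    and "\<rho> > 0"
    and "\<rho>-lipschitz_on UNIV \<phi>"
  shows "(\<forall>Y. ((\<lambda>(Z, \<mu>). moreau_env \<phi> Z \<mu>) \<longlongrightarrow> \<phi> Y) (nhds Y \<times>\<^sub>F at_right 0)) \<and>
    (\<forall>Z. \<forall>\<mu>>0. norm (gradient (\<lambda>W. moreau_env \<phi> W \<mu>) Z) \<le> 2 * \<rho>) \<and>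
    (\<forall>Y. env_gradient_limits \<phi> Y \<subseteq> subdifferential \<phi> Y)"
proof (intro conjI allI impI subsetI)
  note lip = assms(3)
  have cont: "isCont \<phi> Y" for Y
    using lipschitz_on_continuous_on[OF lip] by (simp add: continuous_on_eq_continuous_at)
  have grad: "gradient (\<lambda>W. moreau_env \<phi> W \<mu>) Z = (1 / \<mu>) *\<^sub>R (Z - P)"
    if "\<mu> > 0" "is_prox \<phi> \<mu> Z P" for Z P \<mu>
    by (rule gradient_eqI[OF moreau_env_has_gradient[OF assms(1) lip that]])

  show "((\<lambda>(Z, \<mu>). moreau_env \<phi> Z \<mu>) \<longlongrightarrow> \<phi> Y) (nhds Y \<times>\<^sub>F at_right 0)" for Y
  proof -
    let ?F = "nhds Y \<times>\<^sub>F at_right (0::real)"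
    have fst: "filterlim fst (nhds Y) ?F"
      by (rule filterlim_fst)
    have snd: "filterlim snd (at_right 0) ?F"
      by (rule filterlim_snd)
    have "((\<lambda>x. moreau_env \<phi> (fst x) (snd x) - \<phi> (fst x)) \<longlongrightarrow> 0) ?F"
    proof (rule Lim_null_comparison)
      have "\<forall>\<^sub>F \<mu> in at_right (0::real). 0 < \<mu>"
        by (rule eventually_at_right_less)
      then have "\<forall>\<^sub>F x in ?F. 0 < snd x"
        using snd by (simp add: filterlim_iff)
      then show "\<forall>\<^sub>F x in ?F. norm (moreau_env \<phi> (fst x) (snd x) - \<phi> (fst x))
          \<le> 2 * \<rho>\<^sup>2 * snd x"
        by eventually_elim (simp add: moreau_env_uniform_approx[OF lip])
      have "filterlim snd (nhds 0) ?F"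
        using snd by (simp add: filterlim_at)
      then have "((\<lambda>x. 2 * \<rho>\<^sup>2 * snd x) \<longlongrightarrow> 2 * \<rho>\<^sup>2 * 0) ?F"
        by (intro tendsto_intros)
      then show "((\<lambda>x. 2 * \<rho>\<^sup>2 * snd x) \<longlongrightarrow> 0) ?F"
        by simp
    qed
    moreover have "((\<lambda>x. \<phi> (fst x)) \<longlongrightarrow> \<phi> Y) ?F"
      by (rule isCont_tendsto_compose[OF cont fst])
    ultimately have "((\<lambda>x. moreau_env \<phi> (fst x) (snd x) - \<phi> (fst x) + \<phi> (fst x))
        \<longlongrightarrow> 0 + \<phi> Y) ?F"
      by (rule tendsto_add)
    then show ?thesis
      by (simp add: case_prod_unfold)
  qed

  show "norm (gradient (\<lambda>W. moreau_env \<phi> W \<mu>) Z) \<le> 2 * \<rho>" if pos: "\<mu> > 0" for Z \<mu>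
  proof -
    obtain P where P: "is_prox \<phi> \<mu> Z P"
      using is_prox_exists[OF lip pos] by blast
    show ?thesis
      using is_prox_dist_le[OF lip pos P] pos
      by (simp add: grad[OF pos P] norm_minus_commute[of Z] divide_le_eq mult.commute
          mult.left_commute)
  qed

  show "G \<in> subdifferential \<phi> Y" if "G \<in> env_gradient_limits \<phi> Y" for G Y
  proof -
    obtain Z \<mu> where Z: "Z \<longlonglongrightarrow> Y" and pos: "\<And>k::nat. \<mu> k > 0" and \<mu>: "\<mu> \<longlonglongrightarrow> 0"
      and G: "(\<lambda>k. gradient (\<lambda>W. moreau_env \<phi> W (\<mu> k)) (Z k)) \<longlonglongrightarrow> G"
      using \<open>G \<in> env_gradient_limits \<phi> Y\<close> by (auto simp: env_gradient_limits_def)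
    have "\<forall>k. \<exists>P. is_prox \<phi> (\<mu> k) (Z k) P"
      using is_prox_exists[OF lip pos] by blast
    then obtain P where P: "\<And>k. is_prox \<phi> (\<mu> k) (Z k) (P k)"
      by metis
    have "(\<lambda>k. P k - Z k) \<longlonglongrightarrow> 0"
    proof (rule Lim_null_comparison)
      show "\<forall>\<^sub>F k in sequentially. norm (P k - Z k) \<le> 2 * \<mu> k * \<rho>"
        using is_prox_dist_le[OF lip pos P] by simp
      have "(\<lambda>k. 2 * \<mu> k * \<rho>) \<longlonglongrightarrow> 2 * 0 * \<rho>"
        by (intro tendsto_intros \<mu>)
      then show "(\<lambda>k. 2 * \<mu> k * \<rho>) \<longlonglongrightarrow> 0"
        by simp
    qed
    from tendsto_add[OF this Z] have "P \<longlonglongrightarrow> Y"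
      by simp
    then show ?thesis
    proof (rule subdifferential_closed_graph[OF cont _ G])
      fix k
      show "gradient (\<lambda>W. moreau_env \<phi> W (\<mu> k)) (Z k) \<in> subdifferential \<phi> (P k)"
        unfolding grad[OF pos P] by (rule is_prox_subgradient[OF assms(1) pos P])
    qed
  qed
qed

end
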